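(* Let $\alpha\in[1/3,1)\cup\{0\}$ and, for integers $k\ge 3$, let $$b_k(\alpha):=\binom{\alpha}{k}-(-1)^k\binom{(1-\alpha)/2}{k}-\binom{(1+\alpha)/2}{k}.$$ Then the coefficients $b_k(\alpha)$, $k\ge3$, are non-negative, and for every $u\in C_c(\mathbb{N}_0)$ with $u(0)=0$, $$\sum_{n=1}^\infty |u(n)-u(n-1)|^2 n^\alpha\ \ge\ \frac{(\alpha-1)^2}{4}\sum_{n=1}^\infty \frac{|u(n)|^2}{n^2}\,n^\alpha+\sum_{k=3}^\infty b_k(\alpha)\sum_{n=2}^\infty\frac{|u(n)|^2}{n^k}\,n^\alpha .$$
   Context: $\mathbb{N}_0=\{0,1,2,\dots\}$. $C_c(\mathbb{N}_0)$ is the space of finitely supported real-valued functions on $\mathbb{N}_0$. For real $\gamma$ and integer $k\ge 0$, $\binom{\gamma}{k}=\frac{\gamma(\gamma-1)\cdots(\gamma-k+1)}{k!}$ is the generalized binomial coefficient. *)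

theory Defs
  imports "HOL-Analysis.Infinite_Sum"
begin

definition b :: "nat \<Rightarrow> real \<Rightarrow> real" where
  "b k \<alpha> = (\<alpha> gchoose k) - (- 1) ^ k * (((1 - \<alpha>) / 2) gchoose k) - (((1 + \<alpha>) / 2) gchoose k)"

definition C_c :: "(nat \<Rightarrow> real) set" where
  "C_c = {u. finite {n. u n \<noteq> 0}}"

end

theory Submission
  imports Defs "HOL-Analysis.Generalised_Binomial_Theorem"
begin

text \<open>
  Write \<open>\<beta> = (1 - \<alpha>) / 2\<close> and \<open>\<gamma> = (1 + \<alpha>) / 2\<close>, so that \<open>\<alpha> + \<beta> = \<gamma>\<close> and
  \<open>\<beta> + \<gamma> = 1\<close>.

  The inequality is the supersolution (ground state) method applied to \<open>g n = n powr \<beta>\<close>.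
  Completing a square on every edge bounds the weighted energy from below by the sum of
  \<open>(u n)\<^sup>2 W n\<close>, where \<open>W = - (div (w \<cdot> grad g)) / g\<close> for the edge weights \<open>w n = n powr \<alpha>\<close>
  (lemma \<open>Hardy_inequality_of_supersolution\<close>). With \<open>x = 1 / n\<close> this potential is
  \<open>n powr \<alpha> * V x\<close>, where
  \<open>V x = 1 - (1 - x) powr \<beta> + (1 + x) powr \<alpha> - (1 + x) powr \<gamma>\<close>.
  The binomial series turns \<open>V\<close> into a power series with coefficients \<open>b k \<alpha>\<close>; those of order
  0 and 1 cancel, the one of order 2 is the sharp Hardy constant \<open>(\<alpha> - 1)\<^sup>2 / 4\<close>, and the rest
  is the improvement. At \<open>n = 1\<close> only the quadratic term is claimed, and there
  \<open>V 1 \<ge> 1 / 2 \<ge> (\<alpha> - 1)\<^sup>2 / 4\<close>.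

  For the sign of the coefficients, let \<open>h a k\<close> be the absolute value of \<open>a gchoose k\<close> for
  \<open>0 \<le> a \<le> 1\<close>. Then \<open>b k \<alpha>\<close> equals \<open>h \<beta> k + h \<alpha> k - h \<gamma> k\<close> for odd \<open>k\<close> and
  \<open>h \<beta> k + h \<gamma> k - h \<alpha> k\<close> for even \<open>k\<close>. Since \<open>h a (k + 1) = h a k * (k - a) / (k + 1)\<close>, an
  inequality \<open>h a k \<le> h a' k\<close> with \<open>a \<ge> a'\<close> propagates to all larger \<open>k\<close>. The symmetry
  \<open>h \<beta> 2 = h \<gamma> 2\<close> settles the odd case. In the even case the condition \<open>\<alpha> \<ge> 1/3\<close> says
  exactly that \<open>\<beta> \<le> \<alpha>\<close>, and \<open>h \<alpha> 7 \<le> h \<beta> 7\<close> gives all \<open>k \<ge> 7\<close>; only \<open>k = 4\<close> and \<open>k = 6\<close>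
  remain, and they are polynomial inequalities in \<open>\<alpha>\<close>. For \<open>\<alpha> = 0\<close> the negative term
  \<open>h \<alpha> k\<close> of the even case vanishes.
\<close>

section \<open>Signs and sizes of fractional binomial coefficients\<close>

text \<open>The sign is chosen such that the value is the absolute value of \<open>a gchoose k\<close> whenever
  \<open>0 \<le> a \<le> 1\<close> and \<open>k \<ge> 1\<close>.\<close>

definition abs_gbinomial :: "real \<Rightarrow> nat \<Rightarrow> real" where
  "abs_gbinomial a k = (- 1) ^ (k + 1) * (a gchoose k)"

lemma abs_gbinomial_0: "abs_gbinomial a 0 = - 1"
  by (simp add: abs_gbinomial_def)

lemma abs_gbinomial_1: "abs_gbinomial a (Suc 0) = a"
  by (simp add: abs_gbinomial_def)

lemma abs_gbinomial_Suc:
  "abs_gbinomial a (Suc k) = abs_gbinomial a k * (real k - a) / real (Suc k)"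
proof -
  have "a gchoose Suc k = (a gchoose k) * (a - real k) / real (Suc k)"
    by (simp add: gbinomial_prod_rev field_simps)
  also have "(a gchoose k) * (a - real k) = - ((a gchoose k) * (real k - a))"
    by (simp add: algebra_simps)
  finally have "a gchoose Suc k = - ((a gchoose k) * (real k - a) / real (Suc k))"
    by simp
  then show ?thesis
    by (simp add: abs_gbinomial_def del: of_nat_Suc)
qed

lemma abs_gbinomial_nonneg:
  assumes "0 \<le> a" "a \<le> 1" "1 \<le> k"
  shows "0 \<le> abs_gbinomial a k"
  using \<open>1 \<le> k\<close>
proof (induction k rule: dec_induct)
  case base
  then show ?case using assms by (simp add: abs_gbinomial_1)
next
  case (step k)
  then show ?case using assms by (simp add: abs_gbinomial_Suc)
qed

text \<open>The factor \<open>(k - a) / (k + 1)\<close> picked up in each step decreases with \<open>a\<close>.\<close>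

lemma abs_gbinomial_le_propagate:
  assumes "abs_gbinomial a m \<le> abs_gbinomial a' m" "0 \<le> a'" "a' \<le> a" "a \<le> 1" "1 \<le> m" "m \<le> k"
  shows "abs_gbinomial a k \<le> abs_gbinomial a' k"
  using \<open>m \<le> k\<close>
proof (induction k rule: dec_induct)
  case base
  then show ?case using assms by simp
next
  case (step k)
  have "abs_gbinomial a k * (real k - a) \<le> abs_gbinomial a' k * (real k - a')"
    using assms step by (intro mult_mono abs_gbinomial_nonneg) auto
  then show ?case
    unfolding abs_gbinomial_Suc by (rule divide_right_mono) simp
qed

lemma abs_gbinomial_complement_le:
  assumes "0 \<le> a" "a \<le> 1 / 2" "2 \<le> k"
  shows "abs_gbinomial (1 - a) k \<le> abs_gbinomial a k"
proof (rule abs_gbinomial_le_propagate[where m = 2])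
  \<comment> \<open>Both sides equal \<open>a (1 - a) / 2\<close>.\<close>
  show "abs_gbinomial (1 - a) 2 \<le> abs_gbinomial a 2"
    by (simp add: eval_nat_numeral abs_gbinomial_Suc abs_gbinomial_0)
qed (use assms in auto)

lemma abs_gbinomial_values:
  shows abs_gbinomial_4: "24 * abs_gbinomial a 4 = a * (1 - a) * (2 - a) * (3 - a)"
    and abs_gbinomial_6:
      "720 * abs_gbinomial a 6 = a * (1 - a) * (2 - a) * (3 - a) * (4 - a) * (5 - a)"
    and abs_gbinomial_7:
      "5040 * abs_gbinomial a 7 = a * (1 - a) * (2 - a) * (3 - a) * (4 - a) * (5 - a) * (6 - a)"
  by (simp_all add: eval_nat_numeral abs_gbinomial_Suc abs_gbinomial_0)

text \<open>In terms of \<open>\<beta>\<close> one has \<open>\<alpha> = 1 - 2 \<beta>\<close> and \<open>\<gamma> = 1 - \<beta>\<close>. All three binomial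
  coefficients then contain the factor \<open>\<beta>\<close>. The cofactor is written in \<open>\<delta> = 1 - 3 \<beta>\<close>, which
  runs through \<open>[0, 1]\<close> and vanishes at the critical value \<open>\<alpha> = \<beta> = 1 / 3\<close>; in this variable
  each negative monomial is absorbed by the positive one of the next lower degree.\<close>

lemma abs_gbinomial_base_7:
  fixes \<beta> :: real
  assumes "0 \<le> \<beta>" "\<beta> \<le> 1 / 3"
  shows "abs_gbinomial (1 - 2 * \<beta>) 7 \<le> abs_gbinomial \<beta> 7"
proof -
  define \<delta> where "\<delta> = 1 - 3 * \<beta>"
  have \<delta>: "0 \<le> \<delta>" "\<delta> \<le> 1"
    using assms by (auto simp: \<delta>_def)
  have "243 * (5040 * abs_gbinomial \<beta> 7 - 5040 * abs_gbinomial (1 - 2 * \<beta>) 7) =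
      \<beta> * (\<delta> * (9668 + \<delta> * (147932 - 52135 * \<delta>) + \<delta> ^ 3 * (12265 - 1133 * \<delta>) + 43 * \<delta> ^ 5))"
    unfolding abs_gbinomial_values \<delta>_def by algebra
  also have "\<dots> \<ge> 0"
    using assms \<delta> by (intro mult_nonneg_nonneg add_nonneg_nonneg) auto
  finally show ?thesis by simp
qed

lemma abs_gbinomial_le_sum_4:
  fixes \<beta> :: real
  assumes "0 \<le> \<beta>" "\<beta> \<le> 1 / 3"
  shows "abs_gbinomial (1 - 2 * \<beta>) 4 \<le> abs_gbinomial \<beta> 4 + abs_gbinomial (1 - \<beta>) 4"
proof -
  define \<delta> where "\<delta> = 1 - 3 * \<beta>"
  have \<delta>: "0 \<le> \<delta>" "\<delta> \<le> 1"
    using assms by (auto simp: \<delta>_def)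
  have "27 * (24 * abs_gbinomial \<beta> 4 + 24 * abs_gbinomial (1 - \<beta>) 4
        - 24 * abs_gbinomial (1 - 2 * \<beta>) 4) =
      \<beta> * ((56 - 36 * \<delta>) + \<delta> ^ 2 * (102 - 14 * \<delta>))"
    unfolding abs_gbinomial_values \<delta>_def by algebra
  also have "\<dots> \<ge> 0"
    using assms \<delta> by (intro mult_nonneg_nonneg add_nonneg_nonneg) auto
  finally show ?thesis by simp
qed

lemma abs_gbinomial_le_sum_6:
  fixes \<beta> :: real
  assumes "0 \<le> \<beta>" "\<beta> \<le> 1 / 3"
  shows "abs_gbinomial (1 - 2 * \<beta>) 6 \<le> abs_gbinomial \<beta> 6 + abs_gbinomial (1 - \<beta>) 6"
proof -
  define \<delta> where "\<delta> = 1 - 3 * \<beta>"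
  have \<delta>: "0 \<le> \<delta>" "\<delta> \<le> 1"
    using assms by (auto simp: \<delta>_def)
  have "243 * (720 * abs_gbinomial \<beta> 6 + 720 * abs_gbinomial (1 - \<beta>) 6
        - 720 * abs_gbinomial (1 - 2 * \<beta>) 6) =
      \<beta> * ((7280 - 976 * \<delta>) + \<delta> ^ 2 * (22652 - 6758 * \<delta>) + \<delta> ^ 4 * (1192 - 62 * \<delta>))"
    unfolding abs_gbinomial_values \<delta>_def by algebra
  also have "\<dots> \<ge> 0"
    using assms \<delta> by (intro mult_nonneg_nonneg add_nonneg_nonneg) auto
  finally show ?thesis by simp
qed

text \<open>For \<open>k \<ge> 7\<close> the first summand alone dominates. At \<open>k = 4\<close> this already fails for \<open>\<alpha>\<close>
  slightly above \<open>1 / 3\<close>, so small \<open>k\<close> need the second summand.\<close>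

lemma abs_gbinomial_le_sum_even:
  assumes "0 \<le> \<beta>" "\<beta> \<le> 1 / 3" "3 \<le> k" "even k"
  shows "abs_gbinomial (1 - 2 * \<beta>) k \<le> abs_gbinomial \<beta> k + abs_gbinomial (1 - \<beta>) k"
proof -
  have "k = 4 \<or> k = 6 \<or> 7 \<le> k"
    using assms by presburger
  then show ?thesis
  proof (elim disjE)
    assume "7 \<le> k"
    then have "abs_gbinomial (1 - 2 * \<beta>) k \<le> abs_gbinomial \<beta> k"
      using assms by (intro abs_gbinomial_le_propagate[OF abs_gbinomial_base_7]) auto
    moreover have "0 \<le> abs_gbinomial (1 - \<beta>) k"
      using assms by (intro abs_gbinomial_nonneg) auto
    ultimately show ?thesis by linarith
  qed (use assms abs_gbinomial_le_sum_4 abs_gbinomial_le_sum_6 in auto)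
qed

lemma b_nonneg:
  assumes "\<alpha> \<in> {1/3..<1} \<union> {0}" "3 \<le> k"
  shows "0 \<le> b k \<alpha>"
proof -
  let ?\<beta> = "(1 - \<alpha>) / 2" and ?\<gamma> = "(1 + \<alpha>) / 2"
  have \<alpha>: "0 \<le> \<alpha>" "\<alpha> < 1"
    using assms by auto
  have nonneg: "0 \<le> abs_gbinomial \<alpha> k" "0 \<le> abs_gbinomial ?\<beta> k" "0 \<le> abs_gbinomial ?\<gamma> k"
    using \<alpha> assms by (auto intro!: abs_gbinomial_nonneg)
  show ?thesis
  proof (cases "even k")
    case True
    have "abs_gbinomial \<alpha> k \<le> abs_gbinomial ?\<beta> k + abs_gbinomial ?\<gamma> k"
    proof (cases "\<alpha> = 0")
      case True
      then have "abs_gbinomial \<alpha> k = 0"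
        using assms by (simp add: abs_gbinomial_def gbinomial_0_left)
      then show ?thesis using nonneg by linarith
    next
      case False
      have "1 - 2 * ?\<beta> = \<alpha>" "1 - ?\<beta> = ?\<gamma>"
        by (simp_all add: field_simps)
      moreover have "abs_gbinomial (1 - 2 * ?\<beta>) k \<le> abs_gbinomial ?\<beta> k + abs_gbinomial (1 - ?\<beta>) k"
        using False assms \<open>even k\<close> by (intro abs_gbinomial_le_sum_even) auto
      ultimately show ?thesis by (simp only:)
    qed
    then show ?thesis
      using True by (simp add: b_def abs_gbinomial_def)
  next
    case False
    have "1 - ?\<beta> = ?\<gamma>"
      by (simp add: field_simps)
    moreover have "abs_gbinomial (1 - ?\<beta>) k \<le> abs_gbinomial ?\<beta> k"
      using \<alpha> assms by (intro abs_gbinomial_complement_le) auto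
    ultimately have "abs_gbinomial ?\<gamma> k \<le> abs_gbinomial ?\<beta> k"
      by (simp only:)
    then show ?thesis
      using False nonneg by (simp add: b_def abs_gbinomial_def)
  qed
qed

section \<open>The Hardy potential and its power series\<close>

definition hardy_potential :: "real \<Rightarrow> real \<Rightarrow> real" where
  "hardy_potential \<alpha> x =
    1 - (1 - x) powr ((1 - \<alpha>) / 2) + (1 + x) powr \<alpha> - (1 + x) powr ((1 + \<alpha>) / 2)"

lemma b_2: "b 2 \<alpha> = (\<alpha> - 1) ^ 2 / 4"
  by (simp add: b_def gbinomial_prod_rev eval_nat_numeral field_simps)

text \<open>The constant coefficient of the binomial expansion is \<open>b 0 \<alpha> = -1\<close>; it cancels the
  leading \<open>1\<close> of the potential.\<close>

lemma hardy_potential_has_sum: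
  assumes "\<alpha> \<in> {1/3..<1} \<union> {0}" "0 \<le> x" "x < 1"
  shows "((\<lambda>k. b k \<alpha> * x ^ k) has_sum (hardy_potential \<alpha> x - (\<alpha> - 1) ^ 2 / 4 * x ^ 2)) {3..}"
proof -
  let ?f = "\<lambda>k. b k \<alpha> * x ^ k"
  have x: "\<bar>x\<bar> < 1" "\<bar>- x\<bar> < 1"
    using assms by auto
  have "(\<lambda>k. (\<alpha> gchoose k) * x ^ k - (((1 - \<alpha>) / 2) gchoose k) * (- x) ^ k
        - (((1 + \<alpha>) / 2) gchoose k) * x ^ k)
      sums ((1 + x) powr \<alpha> - (1 + - x) powr ((1 - \<alpha>) / 2) - (1 + x) powr ((1 + \<alpha>) / 2))"
    by (intro sums_diff gen_binomial_real x)
  also have "(\<lambda>k. (\<alpha> gchoose k) * x ^ k - (((1 - \<alpha>) / 2) gchoose k) * (- x) ^ k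
        - (((1 + \<alpha>) / 2) gchoose k) * x ^ k) = ?f"
    by (simp add: fun_eq_iff b_def algebra_simps flip: power_mult_distrib)
  finally have sums: "?f sums (hardy_potential \<alpha> x - 1)"
    by (simp add: hardy_potential_def algebra_simps)
  have "summable (\<lambda>k. norm (?f k))"
  proof (subst summable_cong)
    show "eventually (\<lambda>k. norm (?f k) = ?f k) sequentially"
      using eventually_ge_at_top[of 3]
      by eventually_elim (use assms b_nonneg in auto)
    show "summable ?f"
      using sums by (rule sums_summable)
  qed
  then have "(?f has_sum (hardy_potential \<alpha> x - 1)) UNIV"
    using sums by (rule norm_summable_imp_has_sum)
  then have "(?f has_sum (hardy_potential \<alpha> x - 1 - sum ?f {..<3})) (UNIV - {..<3})"
    by (rule has_sum_Diff) auto
  moreover have "UNIV - {..<3} = {3::nat..}"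
    by auto
  moreover have "sum ?f {..<3} = - 1 + (\<alpha> - 1) ^ 2 / 4 * x ^ 2"
  proof -
    have "b 0 \<alpha> = - 1" "b 1 \<alpha> = 0"
      by (simp_all add: b_def field_simps)
    then show ?thesis
      using b_2[of \<alpha>] by (simp add: eval_nat_numeral)
  qed
  ultimately show ?thesis by simp
qed

text \<open>As \<open>0 powr \<beta> = 0\<close>, with \<open>t = 2 powr (\<alpha> / 2)\<close> the value at \<open>1\<close> is \<open>1 + t\<^sup>2 - sqrt 2 * t\<close>, that is,
  \<open>(t - sqrt 2 / 2)\<^sup>2 + 1 / 2\<close>.\<close>

lemma hardy_potential_1_ge:
  assumes "0 \<le> \<alpha>" "\<alpha> < 1"
  shows "(\<alpha> - 1) ^ 2 / 4 \<le> hardy_potential \<alpha> 1"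
proof -
  define t :: real where "t = 2 powr (\<alpha> / 2)"
  have "2 powr \<alpha> = t ^ 2"
    by (simp add: t_def power2_eq_square flip: powr_add)
  moreover have "2 powr ((1 + \<alpha>) / 2) = sqrt 2 * t"
    by (simp add: t_def add_divide_distrib powr_add powr_half_sqrt)
  ultimately have "hardy_potential \<alpha> 1 = (t - sqrt 2 / 2) ^ 2 + 1 / 2"
    by (simp add: hardy_potential_def power2_diff power_divide)
  then have "1 / 2 \<le> hardy_potential \<alpha> 1"
    by simp
  moreover have "(\<alpha> - 1) ^ 2 \<le> 1"
    using assms by (intro power_le_one_iff[THEN iffD2] abs_square_le_1[THEN iffD2]) auto
  ultimately show ?thesis by linarith
qed

section \<open>The supersolution method\<close>

text \<open>Expanding the square on the left, this is
  \<open>2 x y \<le> x\<^sup>2 q / p + y\<^sup>2 p / q\<close>.\<close>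

lemma edge_energy_ge:
  fixes x y p q :: real
  assumes "0 < p" "0 < q"
  shows "x ^ 2 * (1 - q / p) + y ^ 2 * (1 - p / q) \<le> (x - y) ^ 2"
proof -
  have "(x - y) ^ 2 - (x ^ 2 * (1 - q / p) + y ^ 2 * (1 - p / q)) = (x * q - y * p) ^ 2 / (p * q)"
    using assms by (simp add: field_simps power2_eq_square)
  moreover have "0 \<le> (x * q - y * p) ^ 2 / (p * q)"
    using assms by simp
  ultimately show ?thesis by linarith
qed

text \<open>Each edge \<open>{n - 1, n}\<close> contributes to the potentials of both its end points; collecting the
  contributions at a vertex gives the left-hand side. The edge \<open>{0, 1}\<close> is special because
  \<open>g 0\<close> may vanish, but there \<open>u 0 = 0\<close> leaves only one end point.\<close>

lemma Hardy_inequality_of_supersolution: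
  fixes u w g :: "nat \<Rightarrow> real"
  assumes w: "\<And>n. 0 \<le> w n" and g: "\<And>n. 1 \<le> n \<Longrightarrow> 0 < g n" and "0 \<le> g 0"
    and "u 0 = 0" and u: "\<And>n. N < n \<Longrightarrow> u n = 0"
  shows "(\<Sum>n = 1..N. u n ^ 2 * (w n * (1 - g (n - 1) / g n) + w (n + 1) * (1 - g (n + 1) / g n)))
    \<le> (\<Sum>n = 1..N + 1. (u n - u (n - 1)) ^ 2 * w n)"
proof -
  let ?in = "\<lambda>n. u n ^ 2 * (w n * (1 - g (n - 1) / g n))"
  let ?out = "\<lambda>n. u n ^ 2 * (w (n + 1) * (1 - g (n + 1) / g n))"
  have edge: "?in n + ?out (n - 1) \<le> (u n - u (n - 1)) ^ 2 * w n" if n: "1 \<le> n" for n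
  proof (cases "n = 1")
    case True
    have "u 1 ^ 2 * (w 1 * (1 - g 0 / g 1)) \<le> u 1 ^ 2 * (w 1 * 1)"
      using w g[of 1] \<open>0 \<le> g 0\<close> by (intro mult_left_mono) auto
    then show ?thesis
      using True \<open>u 0 = 0\<close> by simp
  next
    case False
    then have "u n ^ 2 * (1 - g (n - 1) / g n) + u (n - 1) ^ 2 * (1 - g n / g (n - 1))
        \<le> (u n - u (n - 1)) ^ 2"
      using n by (intro edge_energy_ge g) auto
    then have "(u n ^ 2 * (1 - g (n - 1) / g n) + u (n - 1) ^ 2 * (1 - g n / g (n - 1))) * w n
        \<le> (u n - u (n - 1)) ^ 2 * w n"
      using w by (rule mult_right_mono)
    then show ?thesis
      using n by (simp add: algebra_simps)
  qed
  have "(\<Sum>n = 1..N + 1. ?out (n - 1)) = (\<Sum>n = 0..N. ?out n)"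
    by (rule sum.reindex_bij_witness[where i = Suc and j = "\<lambda>n. n - 1"]) auto
  also have "\<dots> = (\<Sum>n = 1..N. ?out n)"
    using \<open>u 0 = 0\<close> by (intro sum.mono_neutral_right) (auto simp: not_less_eq_eq)
  finally have out: "(\<Sum>n = 1..N + 1. ?out (n - 1)) = (\<Sum>n = 1..N. ?out n)" .
  have "(\<Sum>n = 1..N. u n ^ 2 * (w n * (1 - g (n - 1) / g n) + w (n + 1) * (1 - g (n + 1) / g n)))
      = (\<Sum>n = 1..N. ?in n) + (\<Sum>n = 1..N. ?out n)"
    by (simp add: distrib_left sum.distrib)
  also have "\<dots> = (\<Sum>n = 1..N + 1. ?in n) + (\<Sum>n = 1..N + 1. ?out (n - 1))"
    using u[of "N + 1"] by (simp only: out) simp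
  also have "\<dots> \<le> (\<Sum>n = 1..N + 1. (u n - u (n - 1)) ^ 2 * w n)"
    unfolding sum.distrib[symmetric] by (intro sum_mono edge) auto
  finally show ?thesis .
qed

text \<open>The potential of the supersolution \<open>n powr \<beta>\<close> is homogeneous up to a function of
  \<open>1 / n\<close>: on the outgoing edge the powers of \<open>1 + 1 / n\<close> coming from the weight and from the
  supersolution merge because \<open>\<alpha> + \<beta> = \<gamma>\<close>.\<close>

lemma power_supersolution_potential:
  fixes \<alpha> :: real and n :: nat
  assumes "1 \<le> n"
  defines "g \<equiv> \<lambda>m::nat. real m powr ((1 - \<alpha>) / 2)"
  shows "real n powr \<alpha> * (1 - g (n - 1) / g n) + real (n + 1) powr \<alpha> * (1 - g (n + 1) / g n)
    = real n powr \<alpha> * hardy_potential \<alpha> (1 / real n)"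
proof -
  have down: "g (n - 1) / g n = (1 - 1 / real n) powr ((1 - \<alpha>) / 2)"
    using assms by (simp add: g_def diff_divide_distrib of_nat_diff flip: powr_divide)
  have up: "g (n + 1) / g n = (1 + 1 / real n) powr ((1 - \<alpha>) / 2)"
    using assms by (simp add: g_def add_divide_distrib add.commute flip: powr_divide)
  have weight: "real (n + 1) powr \<alpha> = real n powr \<alpha> * (1 + 1 / real n) powr \<alpha>"
    using assms by (simp add: distrib_left add.commute flip: powr_mult)
  have "\<alpha> + (1 - \<alpha>) / 2 = (1 + \<alpha>) / 2"
    by (simp add: field_simps)
  then have "(1 + 1 / real n) powr \<alpha> * (1 + 1 / real n) powr ((1 - \<alpha>) / 2)
      = (1 + 1 / real n) powr ((1 + \<alpha>) / 2)"
    by (simp only: flip: powr_add)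
  then show ?thesis
    unfolding down up weight hardy_potential_def by (simp add: algebra_simps)
qed

section \<open>The improved Hardy inequality\<close>

lemma has_sum_sum:
  fixes f :: "'i \<Rightarrow> 'a \<Rightarrow> real"
  assumes "finite I" "\<And>i. i \<in> I \<Longrightarrow> (f i has_sum s i) A"
  shows "((\<lambda>x. \<Sum>i\<in>I. f i x) has_sum (\<Sum>i\<in>I. s i)) A"
  using assms by (induction I rule: finite_induct) (auto intro: has_sum_add)

lemma infsum_eq_sum_of_support:
  fixes f :: "nat \<Rightarrow> real"
  assumes "\<And>n. N < n \<Longrightarrow> f n = 0"
  shows "(\<Sum>\<^sub>\<infinity>n\<in>{m..}. f n) = (\<Sum>n = m..N. f n)"
proof -
  have "(\<Sum>\<^sub>\<infinity>n\<in>{m..}. f n) = (\<Sum>\<^sub>\<infinity>n\<in>{m..N}. f n)"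
    by (rule infsum_cong_neutral) (use assms in auto)
  then show ?thesis by simp
qed

theorem corollary2p5:
  fixes \<alpha> :: real
  assumes "\<alpha> \<in> {1/3..<1} \<union> {0}"
  shows "(\<forall>k\<ge>3. b k \<alpha> \<ge> 0) \<and>
    (\<forall>u\<in>C_c. u 0 = 0 \<longrightarrow>
      (\<lambda>k. b k \<alpha> * (\<Sum>\<^sub>\<infinity>n\<in>{2..}. \<bar>u n\<bar>^2 / real n ^ k * real n powr \<alpha>)) summable_on {3..} \<and>
      (\<Sum>\<^sub>\<infinity>n\<in>{1..}. \<bar>u n - u (n - 1)\<bar>^2 * real n powr \<alpha>)
        \<ge> (\<alpha> - 1)^2 / 4 * (\<Sum>\<^sub>\<infinity>n\<in>{1..}. \<bar>u n\<bar>^2 / real n ^ 2 * real n powr \<alpha>)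
          + (\<Sum>\<^sub>\<infinity>k\<in>{3..}. b k \<alpha> * (\<Sum>\<^sub>\<infinity>n\<in>{2..}. \<bar>u n\<bar>^2 / real n ^ k * real n powr \<alpha>)))"
proof (intro conjI ballI impI)
  show "\<forall>k\<ge>3. b k \<alpha> \<ge> 0"
    using assms b_nonneg by blast
next
  fix u :: "nat \<Rightarrow> real"
  assume "u \<in> C_c" and u0: "u 0 = 0"
  then have "finite {n. u n \<noteq> 0}"
    by (simp add: C_c_def)
  then obtain N0 where N0: "\<And>n. u n \<noteq> 0 \<Longrightarrow> n \<le> N0"
    unfolding finite_nat_set_iff_bounded_le by blast
  \<comment> \<open>The bound is made positive so that the vertex \<open>1\<close> can be split off below.\<close>
  define N where "N = N0 + 1"
  have u: "u n = 0" if "N < n" for n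
    using N0[of n] that by (auto simp: N_def)
  let ?V = "\<lambda>n. hardy_potential \<alpha> (1 / real n)" and ?c = "(\<alpha> - 1) ^ 2 / 4"
  let ?m = "\<lambda>n. u n ^ 2 * real n powr \<alpha>"
  let ?rem = "\<lambda>k. b k \<alpha> * (\<Sum>\<^sub>\<infinity>n\<in>{2..}. \<bar>u n\<bar>^2 / real n ^ k * real n powr \<alpha>)"
  have "((\<lambda>k. \<Sum>n = 2..N. ?m n * (b k \<alpha> * (1 / real n) ^ k)) has_sum
      (\<Sum>n = 2..N. ?m n * (?V n - ?c * (1 / real n) ^ 2))) {3..}"
    by (intro has_sum_sum has_sum_cmult_right hardy_potential_has_sum assms) auto
  also have "(\<lambda>k. \<Sum>n = 2..N. ?m n * (b k \<alpha> * (1 / real n) ^ k)) = ?rem"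
  proof
    fix k
    have "(\<Sum>\<^sub>\<infinity>n\<in>{2..}. \<bar>u n\<bar>^2 / real n ^ k * real n powr \<alpha>)
        = (\<Sum>n = 2..N. \<bar>u n\<bar>^2 / real n ^ k * real n powr \<alpha>)"
      by (rule infsum_eq_sum_of_support) (simp add: u)
    then show "(\<Sum>n = 2..N. ?m n * (b k \<alpha> * (1 / real n) ^ k)) = ?rem k"
      by (simp add: sum_distrib_left power_divide mult_ac)
  qed
  finally have rem: "(?rem has_sum (\<Sum>n = 2..N. ?m n * (?V n - ?c * (1 / real n) ^ 2))) {3..}" .
  then show "?rem summable_on {3..}"
    by (rule has_sum_imp_summable)

  have "(\<Sum>\<^sub>\<infinity>n\<in>{1..}. \<bar>u n\<bar>^2 / real n ^ 2 * real n powr \<alpha>)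
      = (\<Sum>n = 1..N. \<bar>u n\<bar>^2 / real n ^ 2 * real n powr \<alpha>)"
    by (rule infsum_eq_sum_of_support) (simp add: u)
  then have "?c * (\<Sum>\<^sub>\<infinity>n\<in>{1..}. \<bar>u n\<bar>^2 / real n ^ 2 * real n powr \<alpha>)
      = (\<Sum>n = 1..N. ?m n * (?c * (1 / real n) ^ 2))"
    by (simp add: sum_distrib_left power_divide mult_ac)
  also have "\<dots> = ?m 1 * ?c + (\<Sum>n = 2..N. ?m n * (?c * (1 / real n) ^ 2))"
    by (simp add: N_def sum.atLeast_Suc_atMost numeral_2_eq_2)
  finally have "?c * (\<Sum>\<^sub>\<infinity>n\<in>{1..}. \<bar>u n\<bar>^2 / real n ^ 2 * real n powr \<alpha>) + infsum ?rem {3..}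
      = ?m 1 * ?c + (\<Sum>n = 2..N. ?m n * ?V n)"
    unfolding infsumI[OF rem] right_diff_distrib sum_subtractf by linarith
  also have "\<dots> \<le> ?m 1 * ?V 1 + (\<Sum>n = 2..N. ?m n * ?V n)"
    using hardy_potential_1_ge[of \<alpha>] assms by (intro add_right_mono mult_left_mono) auto
  also have "\<dots> = (\<Sum>n = 1..N. ?m n * ?V n)"
    by (simp add: N_def sum.atLeast_Suc_atMost numeral_2_eq_2)
  also have "\<dots> = (\<Sum>n = 1..N. u n ^ 2 * (real n powr \<alpha> *
        (1 - real (n - 1) powr ((1 - \<alpha>) / 2) / real n powr ((1 - \<alpha>) / 2)) +
        real (n + 1) powr \<alpha> *
        (1 - real (n + 1) powr ((1 - \<alpha>) / 2) / real n powr ((1 - \<alpha>) / 2))))"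
    by (intro sum.cong refl, subst power_supersolution_potential) auto
  also have "\<dots> \<le> (\<Sum>n = 1..N + 1. (u n - u (n - 1)) ^ 2 * real n powr \<alpha>)"
    by (rule Hardy_inequality_of_supersolution) (use u u0 in auto)
  also have "\<dots> = (\<Sum>\<^sub>\<infinity>n\<in>{1..}. \<bar>u n - u (n - 1)\<bar>^2 * real n powr \<alpha>)"
    by (subst infsum_eq_sum_of_support[where N = "N + 1"]) (auto simp: u)
  finally show "(\<Sum>\<^sub>\<infinity>n\<in>{1..}. \<bar>u n - u (n - 1)\<bar>^2 * real n powr \<alpha>)
      \<ge> ?c * (\<Sum>\<^sub>\<infinity>n\<in>{1..}. \<bar>u n\<bar>^2 / real n ^ 2 * real n powr \<alpha>) + infsum ?rem {3..}" .
qed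

end
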